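(* An algebra $(A,\rightarrow,\rightsquigarrow,1)$ of type $(2,2,0)$ is a commutative pseudo-BE algebra if and only if it satisfies, for all $x,y,z\in A$: $(P_1)$ $1\rightarrow x=1\rightsquigarrow x=x$; $(P_2)$ $x\rightarrow 1=x\rightsquigarrow 1=1$; $(P_3)$ $(x\rightarrow z)\rightsquigarrow(y\rightarrow z)=(z\rightarrow x)\rightsquigarrow(y\rightarrow x)$ and $(x\rightsquigarrow z)\rightarrow(y\rightsquigarrow z)=(z\rightsquigarrow x)\rightarrow(y\rightsquigarrow x)$; $(P_4)$ $x\rightarrow(y\rightsquigarrow z)=y\rightsquigarrow(x\rightarrow z)$; $(P_5)$ $x\rightarrow y=1$ iff $x\rightsquigarrow y=1$.
   Context: A pseudo-BE algebra is an algebra $(A,\rightarrow,\rightsquigarrow,1)$ of type $(2,2,0)$ such that for all $x,y,z\in A$: $x\rightarrow x=x\rightsquigarrow x=1$; $x\rightarrow 1=x\rightsquigarrow 1=1$; $1\rightarrow x=1\rightsquigarrow x=x$; $x\rightarrow(y\rightsquigarrow z)=y\rightsquigarrow(x\rightarrow z)$; $x\rightarrow y=1$ iff $x\rightsquigarrow y=1$. It is commutative if $(x\rightarrow y)\rightsquigarrow y=(y\rightarrow x)\rightsquigarrow x$ and $(x\rightsquigarrow y)\rightarrow y=(y\rightsquigarrow x)\rightarrow x$ for all $x,y\in A$. *)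

theory Defs
  imports Main
begin

locale algebra_2_2_0 =
  fixes A :: "'a set"
    and imp1 :: "'a \<Rightarrow> 'a \<Rightarrow> 'a"  (infixr "\<rightarrow>" 65)
    and imp2 :: "'a \<Rightarrow> 'a \<Rightarrow> 'a"  (infixr "\<leadsto>" 65)
    and one :: 'a  ("\<one>")
  assumes imp1_closed: "\<lbrakk>x \<in> A; y \<in> A\<rbrakk> \<Longrightarrow> x \<rightarrow> y \<in> A"
    and imp2_closed: "\<lbrakk>x \<in> A; y \<in> A\<rbrakk> \<Longrightarrow> x \<leadsto> y \<in> A"
    and one_closed: "\<one> \<in> A"

locale pseudo_BE_algebra = algebra_2_2_0 +
  assumes imp1_refl: "x \<in> A \<Longrightarrow> x \<rightarrow> x = \<one>"
    and imp2_refl: "x \<in> A \<Longrightarrow> x \<leadsto> x = \<one>"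
    and imp1_one: "x \<in> A \<Longrightarrow> x \<rightarrow> \<one> = \<one>"
    and imp2_one: "x \<in> A \<Longrightarrow> x \<leadsto> \<one> = \<one>"
    and one_imp1: "x \<in> A \<Longrightarrow> \<one> \<rightarrow> x = x"
    and one_imp2: "x \<in> A \<Longrightarrow> \<one> \<leadsto> x = x"
    and exchange: "\<lbrakk>x \<in> A; y \<in> A; z \<in> A\<rbrakk> \<Longrightarrow> x \<rightarrow> (y \<leadsto> z) = y \<leadsto> (x \<rightarrow> z)"
    and imp1_eq_one_iff: "\<lbrakk>x \<in> A; y \<in> A\<rbrakk> \<Longrightarrow> x \<rightarrow> y = \<one> \<longleftrightarrow> x \<leadsto> y = \<one>"

locale commutative_pseudo_BE_algebra = pseudo_BE_algebra +
  assumes comm1: "\<lbrakk>x \<in> A; y \<in> A\<rbrakk> \<Longrightarrow> (x \<rightarrow> y) \<leadsto> y = (y \<rightarrow> x) \<leadsto> x"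
    and comm2: "\<lbrakk>x \<in> A; y \<in> A\<rbrakk> \<Longrightarrow> (x \<leadsto> y) \<rightarrow> y = (y \<leadsto> x) \<rightarrow> x"

end

theory Submission
  imports Defs
begin

text \<open>
  By exchange, \<open>(x \<rightarrow> z) \<leadsto> (y \<rightarrow> z) = y \<rightarrow> ((x \<rightarrow> z) \<leadsto> z)\<close>, so \<open>(P\<^sub>3)\<close> is
  commutativity with \<open>y \<rightarrow> _\<close> applied to both sides. Conversely, putting \<open>y = \<one>\<close>
  in \<open>(P\<^sub>3)\<close> gives back commutativity, and \<open>x = y = \<one>\<close> gives \<open>z \<leadsto> z = \<one> \<leadsto> \<one> = \<one>\<close>.
\<close>

context commutative_pseudo_BE_algebra
begin

lemma imp1_imp2_imp1_swap:
  assumes "x \<in> A" "y \<in> A" "z \<in> A"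
  shows "(x \<rightarrow> z) \<leadsto> (y \<rightarrow> z) = (z \<rightarrow> x) \<leadsto> (y \<rightarrow> x)"
proof -
  have "(x \<rightarrow> z) \<leadsto> (y \<rightarrow> z) = y \<rightarrow> ((x \<rightarrow> z) \<leadsto> z)"
    using assms by (simp add: exchange imp1_closed)
  also have "\<dots> = y \<rightarrow> ((z \<rightarrow> x) \<leadsto> x)"
    using assms by (simp add: comm1)
  also have "\<dots> = (z \<rightarrow> x) \<leadsto> (y \<rightarrow> x)"
    using assms by (simp add: exchange imp1_closed)
  finally show ?thesis .
qed

text \<open>Interchanging the two arrows turns \<open>exchange\<close> into itself, up to renaming
  and reversal of the equation, and \<open>comm1\<close> into \<open>comm2\<close>, so the previous
  argument dualizes.\<close>

lemma imp2_imp1_imp2_swap: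
  assumes "x \<in> A" "y \<in> A" "z \<in> A"
  shows "(x \<leadsto> z) \<rightarrow> (y \<leadsto> z) = (z \<leadsto> x) \<rightarrow> (y \<leadsto> x)"
proof -
  have "(x \<leadsto> z) \<rightarrow> (y \<leadsto> z) = y \<leadsto> ((x \<leadsto> z) \<rightarrow> z)"
    using assms by (simp add: exchange imp2_closed)
  also have "\<dots> = y \<leadsto> ((z \<leadsto> x) \<rightarrow> x)"
    using assms by (simp add: comm2)
  also have "\<dots> = (z \<leadsto> x) \<rightarrow> (y \<leadsto> x)"
    using assms by (simp add: exchange imp2_closed)
  finally show ?thesis .
qed

end

theorem theorem4p13:
  fixes A :: "'a set"
    and imp1 :: "'a \<Rightarrow> 'a \<Rightarrow> 'a"  (infixr "\<rightarrow>" 65)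
    and imp2 :: "'a \<Rightarrow> 'a \<Rightarrow> 'a"  (infixr "\<leadsto>" 65)
    and one :: 'a  ("\<one>")
  assumes "algebra_2_2_0 A (\<rightarrow>) (\<leadsto>) \<one>"
  shows "commutative_pseudo_BE_algebra A (\<rightarrow>) (\<leadsto>) \<one> \<longleftrightarrow>
    (\<forall>x\<in>A. \<one> \<rightarrow> x = x \<and> \<one> \<leadsto> x = x) \<and>
    (\<forall>x\<in>A. x \<rightarrow> \<one> = \<one> \<and> x \<leadsto> \<one> = \<one>) \<and>
    (\<forall>x\<in>A. \<forall>y\<in>A. \<forall>z\<in>A.
      (x \<rightarrow> z) \<leadsto> (y \<rightarrow> z) = (z \<rightarrow> x) \<leadsto> (y \<rightarrow> x) \<and>
      (x \<leadsto> z) \<rightarrow> (y \<leadsto> z) = (z \<leadsto> x) \<rightarrow> (y \<leadsto> x)) \<and>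
    (\<forall>x\<in>A. \<forall>y\<in>A. \<forall>z\<in>A. x \<rightarrow> (y \<leadsto> z) = y \<leadsto> (x \<rightarrow> z)) \<and>
    (\<forall>x\<in>A. \<forall>y\<in>A. x \<rightarrow> y = \<one> \<longleftrightarrow> x \<leadsto> y = \<one>)"
  (is "?C \<longleftrightarrow> ?P")
proof
  assume ?C
  then interpret commutative_pseudo_BE_algebra A "(\<rightarrow>)" "(\<leadsto>)" \<one> .
  show ?P
    by (intro conjI ballI)
      (simp_all only: one_imp1 one_imp2 imp1_one imp2_one imp1_imp2_imp1_swap
        imp2_imp1_imp2_swap exchange imp1_eq_one_iff)
next
  assume P: ?P
  \<comment> \<open>This provides \<open>one_closed\<close>, which allows \<one> as a value in
    \<open>swap\<close>, and settles the closure part of \<open>?C\<close>.\<close>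
  interpret algebra_2_2_0 A "(\<rightarrow>)" "(\<leadsto>)" \<one>
    by (fact assms)
  have unit: "\<one> \<rightarrow> x = x" "\<one> \<leadsto> x = x" "x \<rightarrow> \<one> = \<one>" "x \<leadsto> \<one> = \<one>" if "x \<in> A" for x
    using P that by blast+
  have swap: "(x \<rightarrow> z) \<leadsto> (y \<rightarrow> z) = (z \<rightarrow> x) \<leadsto> (y \<rightarrow> x)"
    "(x \<leadsto> z) \<rightarrow> (y \<leadsto> z) = (z \<leadsto> x) \<rightarrow> (y \<leadsto> x)"
    if "x \<in> A" "y \<in> A" "z \<in> A" for x y z
    using P that by blast+
  show ?C
  proof
    fix x y z
    assume x: "x \<in> A"
    \<comment> \<open>The outer arrow survives: the first half of \<open>swap\<close> yields
      reflexivity of \<open>\<leadsto>\<close>, the second that of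
      \<open>\<rightarrow>\<close>.\<close>
    show "x \<rightarrow> x = \<one>" "x \<leadsto> x = \<one>"
      using swap[OF one_closed one_closed x] x by (simp_all add: unit one_closed)
    show "\<one> \<rightarrow> x = x" "\<one> \<leadsto> x = x" "x \<rightarrow> \<one> = \<one>" "x \<leadsto> \<one> = \<one>"
      using x by (fact unit)+
    assume y: "y \<in> A"
    show "x \<rightarrow> y = \<one> \<longleftrightarrow> x \<leadsto> y = \<one>"
      using P x y by blast
    \<comment> \<open>The middle argument of \<open>swap\<close> is \<one>, and \<open>y\<close>
      takes the place of its \<open>z\<close>; the inner terms \<open>\<one> \<rightarrow> y\<close>
      and \<open>\<one> \<rightarrow> x\<close>, and their \<open>\<leadsto>\<close> counterparts,
      reduce to \<open>y\<close> and \<open>x\<close>.\<close>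
    show "(x \<rightarrow> y) \<leadsto> y = (y \<rightarrow> x) \<leadsto> x" "(x \<leadsto> y) \<rightarrow> y = (y \<leadsto> x) \<rightarrow> x"
      using swap[OF x one_closed y] x y by (simp_all add: unit)
    assume z: "z \<in> A"
    show "x \<rightarrow> (y \<leadsto> z) = y \<leadsto> (x \<rightarrow> z)"
      using P x y z by blast
  qed
qed

end
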